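(* Suppose that $S$ is a domain and $R$ is a subring of $S$ strongly twisted by a torsion-free $S$-module $K$. Let $D$ be the derivation that strongly twists $R$. The ring $R$ is a Noetherian domain if and only if $S$ is a Noetherian domain and for each $0\neq a\in S\cap \operatorname{Ker} D$, $K/aK$ is a finitely generated $S$-module.
   Context: All rings are commutative with identity. For a domain $S$ with quotient field $F$ and a torsion-free $S$-module $K$, $FK$ denotes the divisible hull $F\otimes_S K$ (which contains $K$). A derivation $D$ from a ring $B$ to a $B$-module $L$ is an additive map with $D(st)=sD(t)+tD(s)$ for all $s,t\in B$. A subring $R$ of $S$ is strongly twisted by $K$ if there is a derivation $D:F\to FK$ such that: (a) $R=S\cap D^{-1}(K)$; (b) $D(F)$ generates $FK$ as an $F$-vector space; and (c) $S\subseteq \operatorname{Ker} D+sS$ for all $0\neq s\in S$. Such a $D$ is said to strongly twist $R$ by $K$. *)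

theory Defs
  imports
    "HOL-Algebra.Ring_Divisibility"
    "HOL-Algebra.Subrings"
    "HOL-Algebra.Algebraic_Closure_Type"
    "HOL-Computational_Algebra.Polynomial_Factorial"
    "HOL-Library.Poly_Mapping"
    "HOL-Library.Set_Algebras"
begin

text \<open>
  The domain $S$ is a type of class \<^class>\<open>idom\<close>, its quotient field $F$ is the library type
  of fractions over it, and $S$ is identified with its image under \<^const>\<open>to_fract\<close>.
  A module is given by its scalar multiplication, as in the locale \<^locale>\<open>Modules.module\<close>.
\<close>

definition torsion_free_module :: "('s::idom \<Rightarrow> 'k::ab_group_add \<Rightarrow> 'k) \<Rightarrow> bool" where
  "torsion_free_module scaleK \<longleftrightarrow>
     Modules.module scaleK \<and> (\<forall>s k. scaleK s k = 0 \<longrightarrow> s = 0 \<or> k = 0)"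


subsection \<open>The divisible hull $F \otimes_S K$\<close>

text \<open>
  The tensor product $F \otimes_S K$ is the free abelian group on $F \times K$ modulo the
  following subgroup of relations; \<open>frag_of (x, k)\<close> stands for the symbol $x \otimes k$.
\<close>

inductive_set tensor_relations ::
    "('s::idom \<Rightarrow> 'k::ab_group_add \<Rightarrow> 'k) \<Rightarrow> (('s fract \<times> 'k) \<Rightarrow>\<^sub>0 int) set"
  for scaleK where
  add_left:
    "frag_of (x + y, k) - frag_of (x, k) - frag_of (y, k) \<in> tensor_relations scaleK"
| add_right:
    "frag_of (x, k + l) - frag_of (x, k) - frag_of (x, l) \<in> tensor_relations scaleK"
| balanced:
    "frag_of (x * to_fract s, k) - frag_of (x, scaleK s k) \<in> tensor_relations scaleK"
| zero: "0 \<in> tensor_relations scaleK"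
| diff: "p \<in> tensor_relations scaleK \<Longrightarrow> q \<in> tensor_relations scaleK \<Longrightarrow>
    p - q \<in> tensor_relations scaleK"

text \<open>The additive extension of $x \otimes k \mapsto x \cdot \iota(k)$ to formal sums.\<close>

definition tensor_eval ::
    "('s::idom fract \<Rightarrow> 'v::ab_group_add \<Rightarrow> 'v) \<Rightarrow> ('k \<Rightarrow> 'v) \<Rightarrow>
     (('s fract \<times> 'k) \<Rightarrow>\<^sub>0 int) \<Rightarrow> 'v" where
  "tensor_eval scaleFK \<iota> p =
     (\<Sum>z\<in>Poly_Mapping.keys p.
        scaleFK (of_int (Poly_Mapping.lookup p z) * fst z) (\<iota> (snd z)))"

text \<open>
  The $F$-vector space \<open>scaleFK\<close> together with $\iota$ is $F \otimes_S K$ with the canonical map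
  $k \mapsto 1 \otimes k$: the map $x \otimes k \mapsto x \cdot \iota(k)$ is onto, and its kernel
  on formal sums is exactly the group of tensor relations. Inside $FK$, the module $K$ is
  \<open>range \<iota>\<close>.
\<close>

definition is_divisible_hull ::
    "('s::idom \<Rightarrow> 'k::ab_group_add \<Rightarrow> 'k) \<Rightarrow> ('s fract \<Rightarrow> 'v::ab_group_add \<Rightarrow> 'v) \<Rightarrow>
     ('k \<Rightarrow> 'v) \<Rightarrow> bool" where
  "is_divisible_hull scaleK scaleFK \<iota> \<longleftrightarrow>
     Vector_Spaces.vector_space scaleFK \<and>
     range (tensor_eval scaleFK \<iota>) = UNIV \<and>
     {p. tensor_eval scaleFK \<iota> p = 0} = tensor_relations scaleK"


lemma tensor_eval_superset:
  assumes "Modules.module scaleFK" and "finite A" and "Poly_Mapping.keys p \<subseteq> A"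
  shows "tensor_eval scaleFK \<iota> p =
    (\<Sum>z\<in>A. scaleFK (of_int (Poly_Mapping.lookup p z) * fst z) (\<iota> (snd z)))"
proof -
  interpret V: Modules.module scaleFK by fact
  show ?thesis unfolding tensor_eval_def
    by (rule sum.mono_neutral_left) (use assms in \<open>auto simp: in_keys_iff\<close>)
qed

lemma tensor_eval_diff:
  assumes "Modules.module scaleFK"
  shows "tensor_eval scaleFK \<iota> (p - q) = tensor_eval scaleFK \<iota> p - tensor_eval scaleFK \<iota> q"
proof -
  interpret V: Modules.module scaleFK by fact
  let ?A = "Poly_Mapping.keys p \<union> Poly_Mapping.keys q"
  have fin: "finite ?A" by simp
  show ?thesis
    unfolding tensor_eval_superset[OF assms fin keys_diff]
      tensor_eval_superset[OF assms fin Un_upper1] tensor_eval_superset[OF assms fin Un_upper2]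
    by (simp add: lookup_minus sum_subtractf V.scale_left_diff_distrib left_diff_distrib)
qed

lemma tensor_eval_zero: "tensor_eval scaleFK \<iota> 0 = 0"
  by (simp add: tensor_eval_def)

lemma tensor_eval_frag_of: "tensor_eval scaleFK \<iota> (frag_of (x, k)) = scaleFK x (\<iota> k)"
  by (simp add: tensor_eval_def)

lemma fract_denominator: "\<exists>d. d \<noteq> 0 \<and> to_fract d * x \<in> range to_fract"
proof (cases x)
  case (Fract a b)
  then have "to_fract b * x = to_fract a" by (simp add: Fract_conv_to_fract)
  with Fract show ?thesis by blast
qed

lemma tensor_relations_add:
  assumes "p \<in> tensor_relations scaleK" "q \<in> tensor_relations scaleK"
  shows "p + q \<in> tensor_relations scaleK"
  using tensor_relations.diff[OF assms(1) tensor_relations.diff[OF tensor_relations.zero assms(2)]]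
  by simp

text \<open>Clearing denominators: $h_d(\sum n\,(x \otimes k)) = \sum n\,(dx)k$ where $dx \in S$.\<close>

definition tensor_clear ::
    "('s::idom \<Rightarrow> 'k::ab_group_add \<Rightarrow> 'k) \<Rightarrow> 's \<Rightarrow> (('s fract \<times> 'k) \<Rightarrow>\<^sub>0 int) \<Rightarrow> 'k" where
  "tensor_clear scaleK d p =
     (\<Sum>z\<in>Poly_Mapping.keys p.
        scaleK (of_int (Poly_Mapping.lookup p z) * inv_into UNIV to_fract (to_fract d * fst z)) (snd z))"

lemma tensor_clear_superset:
  assumes "Modules.module scaleK" and "finite A" and "Poly_Mapping.keys p \<subseteq> A"
  shows "tensor_clear scaleK d p =
    (\<Sum>z\<in>A. scaleK (of_int (Poly_Mapping.lookup p z) * inv_into UNIV to_fract (to_fract d * fst z)) (snd z))"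
proof -
  interpret V: Modules.module scaleK by fact
  show ?thesis unfolding tensor_clear_def
    by (rule sum.mono_neutral_left) (use assms in \<open>auto simp: in_keys_iff\<close>)
qed

lemma tensor_clear_diff:
  assumes "Modules.module scaleK"
  shows "tensor_clear scaleK d (p - q) = tensor_clear scaleK d p - tensor_clear scaleK d q"
proof -
  interpret V: Modules.module scaleK by fact
  let ?A = "Poly_Mapping.keys p \<union> Poly_Mapping.keys q"
  have fin: "finite ?A" by simp
  show ?thesis
    unfolding tensor_clear_superset[OF assms fin keys_diff]
      tensor_clear_superset[OF assms fin Un_upper1] tensor_clear_superset[OF assms fin Un_upper2]
    by (simp add: lookup_minus sum_subtractf V.scale_left_diff_distrib left_diff_distrib)
qed

lemma tensor_clear_frag_of:
  assumes "to_fract d * x = to_fract s"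
  shows "tensor_clear scaleK d (frag_of (x, k)) = scaleK s k"
proof -
  have "inj (to_fract :: 'a \<Rightarrow> _)" by (auto intro: injI)
  then show ?thesis using assms by (simp add: tensor_clear_def)
qed

lemma tensor_relations_clear:
  assumes "Modules.module scaleK" and "p \<in> tensor_relations scaleK"
  shows "\<exists>d. d \<noteq> 0 \<and> (\<forall>e. tensor_clear scaleK (e * d) p = 0)"
  using assms(2)
proof induction
  interpret V: Modules.module scaleK by fact
  note [simp] = tensor_clear_diff[OF assms(1)]
  {
    case (add_left x y k)
    obtain d d' s t where d: "d \<noteq> 0" "to_fract d * x = to_fract s"
      and d': "d' \<noteq> 0" "to_fract d' * y = to_fract t"
      using fract_denominator[of x] fract_denominator[of y] by blast
    have "tensor_clear scaleK (e * (d * d')) (frag_of (x + y, k) - frag_of (x, k) - frag_of (y, k)) = 0" for e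
    proof -
      have x: "to_fract (e * (d * d')) * x = to_fract (e * d' * s)"
        using d(2) by (simp add: ac_simps)
      have y: "to_fract (e * (d * d')) * y = to_fract (e * d * t)"
        using d'(2) by (simp add: ac_simps)
      have xy: "to_fract (e * (d * d')) * (x + y) = to_fract (e * d' * s + e * d * t)"
        unfolding distrib_left x y by simp
      show ?thesis
        by (simp only: tensor_clear_diff[OF assms(1)] tensor_clear_frag_of[OF x] tensor_clear_frag_of[OF y] tensor_clear_frag_of[OF xy])
           (simp add: V.scale_left_distrib)
    qed
    with d(1) d'(1) show ?case by (intro exI[of _ "d * d'"]) simp
  next
    case (add_right x k l)
    obtain d s where d: "d \<noteq> 0" "to_fract d * x = to_fract s"
      using fract_denominator[of x] by blast
    have "tensor_clear scaleK (e * d) (frag_of (x, k + l) - frag_of (x, k) - frag_of (x, l)) = 0" for e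
    proof -
      have x: "to_fract (e * d) * x = to_fract (e * s)"
        using d(2) by (simp add: ac_simps)
      show ?thesis
        by (simp only: tensor_clear_diff[OF assms(1)] tensor_clear_frag_of[OF x])
           (simp add: V.scale_right_distrib)
    qed
    with d(1) show ?case by blast
  next
    case (balanced x s k)
    obtain d t where d: "d \<noteq> 0" "to_fract d * x = to_fract t"
      using fract_denominator[of x] by blast
    have "tensor_clear scaleK (e * d) (frag_of (x * to_fract s, k) - frag_of (x, scaleK s k)) = 0" for e
    proof -
      have x: "to_fract (e * d) * x = to_fract (e * t)"
        using d(2) by (simp add: ac_simps)
      then have xs: "to_fract (e * d) * (x * to_fract s) = to_fract (e * t * s)"
        by (simp flip: mult.assoc)
      show ?thesis
        by (simp only: tensor_clear_diff[OF assms(1)] tensor_clear_frag_of[OF x] tensor_clear_frag_of[OF xs])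
           simp
    qed
    with d(1) show ?case by blast
  next
    case zero
    show ?case by (auto simp: tensor_clear_def intro: exI[of _ 1])
  next
    case (diff p q)
    then obtain d d' where "d \<noteq> 0" "\<And>e. tensor_clear scaleK (e * d) p = 0"
      "d' \<noteq> 0" "\<And>e. tensor_clear scaleK (e * d') q = 0" by blast
    then have "d * d' \<noteq> 0" "tensor_clear scaleK (e * (d * d')) (p - q) = 0" for e
      by (simp, metis tensor_clear_diff[OF assms(1)] mult.assoc mult.commute diff_zero)
    then show ?case by blast
  }
qed

lemma tensor_relations_frag_of_fract:
  assumes "Modules.module scaleK"
  shows "\<exists>d k. d \<noteq> 0 \<and> p - frag_of (1 / to_fract d, k) \<in> tensor_relations scaleK"
proof -
  interpret V: Modules.module scaleK by fact
  let ?R = "tensor_relations scaleK"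
  have move: "frag_of (1 / to_fract d, k) - frag_of (1 / to_fract (d * e), scaleK e k) \<in> ?R"
    if "d \<noteq> 0" "e \<noteq> 0" for d e k
    using tensor_relations.balanced[of "1 / to_fract (d * e)" e k scaleK] that by simp
  have neg: "- frag_of (x, 0) \<in> ?R" for x
    using tensor_relations.add_right[of x 0 0 scaleK] by simp
  have "Poly_Mapping.keys p \<subseteq> UNIV" by simp
  then show ?thesis
  proof (induction p rule: frag_induction)
    case zero
    show ?case using neg[of 1] by (intro exI[of _ 1] exI[of _ 0]) simp
  next
    case (one z)
    obtain x k where z: "z = (x, k)" by (cases z)
    obtain d s where d: "d \<noteq> 0" "to_fract d * x = to_fract s"
      using fract_denominator[of x] by blast
    have "x = 1 / to_fract d * to_fract s" using d by (simp add: field_simps)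
    then have "frag_of z - frag_of (1 / to_fract d, scaleK s k) \<in> ?R"
      using tensor_relations.balanced[of "1 / to_fract d" s k scaleK] z by simp
    with d(1) show ?case by blast
  next
    case (diff p q)
    then obtain d k e l where d: "d \<noteq> 0" "p - frag_of (1 / to_fract d, k) \<in> ?R"
      and e: "e \<noteq> 0" "q - frag_of (1 / to_fract e, l) \<in> ?R" by blast
    let ?x = "1 / to_fract (d * e)" and ?k = "scaleK e k" and ?l = "scaleK d l"
    have 1: "p - frag_of (?x, ?k) \<in> ?R"
      using tensor_relations_add[OF d(2) move[OF d(1) e(1), of k]] by simp
    have 2: "q - frag_of (?x, ?l) \<in> ?R"
      using tensor_relations_add[OF e(2) move[OF e(1) d(1), of l]] by (simp add: mult.commute)
    have 3: "frag_of (?x, ?k) - frag_of (?x, ?k - ?l) - frag_of (?x, ?l) \<in> ?R"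
      using tensor_relations.add_right[of ?x "?k - ?l" ?l scaleK] by simp
    have "(p - frag_of (?x, ?k)) - (q - frag_of (?x, ?l))
        + (frag_of (?x, ?k) - frag_of (?x, ?k - ?l) - frag_of (?x, ?l)) \<in> ?R"
      by (intro tensor_relations_add tensor_relations.diff 1 2 3)
    then have "(p - q) - frag_of (?x, ?k - ?l) \<in> ?R" by (simp add: algebra_simps)
    moreover have "d * e \<noteq> 0" using d e by simp
    ultimately show ?case by blast
  qed
qed

text \<open>
  For torsion-free $K$ this is the divisible hull in the usual sense: $\iota$ is an $S$-linear
  embedding into an $F$-vector space all of whose elements have the form $s^{-1}\iota(k)$.
\<close>

lemma is_divisible_hull_iff:
  assumes "torsion_free_module scaleK"
  shows "is_divisible_hull scaleK scaleFK \<iota> \<longleftrightarrow>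
    Vector_Spaces.vector_space scaleFK \<and>
    (\<forall>k l. \<iota> (k + l) = \<iota> k + \<iota> l) \<and>
    (\<forall>s k. \<iota> (scaleK s k) = scaleFK (to_fract s) (\<iota> k)) \<and>
    inj \<iota> \<and> (\<forall>v. \<exists>s k. s \<noteq> 0 \<and> scaleFK (to_fract s) v = \<iota> k)"
    (is "?L \<longleftrightarrow> ?R")
proof
  have M: "Modules.module scaleK" and tf: "\<And>s k. scaleK s k = 0 \<Longrightarrow> s = 0 \<or> k = 0"
    using assms by (auto simp: torsion_free_module_def)
  interpret K: Modules.module scaleK by fact
  {
    assume L: ?L
    then interpret V: Vector_Spaces.vector_space scaleFK by (simp add: is_divisible_hull_def)
    have VM: "Modules.module scaleFK" ..
    note ev = tensor_eval_diff[OF VM] tensor_eval_frag_of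
    have ker: "tensor_eval scaleFK \<iota> p = 0 \<longleftrightarrow> p \<in> tensor_relations scaleK" for p
      using L by (auto simp: is_divisible_hull_def)
    have add: "\<iota> (k + l) = \<iota> k + \<iota> l" for k l
      using tensor_relations.add_right[of 1 k l scaleK]
      by (simp add: ker[symmetric] ev eq_diff_eq diff_eq_eq add.commute)
    have scale: "\<iota> (scaleK s k) = scaleFK (to_fract s) (\<iota> k)" for s k
      using tensor_relations.balanced[of 1 s k scaleK] by (simp add: ker[symmetric] ev)
    interpret A: Modules.additive \<iota> by unfold_locales (rule add)
    have "k = 0" if "\<iota> k = 0" for k
    proof -
      have "frag_of (1, k) \<in> tensor_relations scaleK"
        using that by (simp add: ker[symmetric] ev)
      then obtain d where "d \<noteq> 0" "\<And>e. tensor_clear scaleK (e * d) (frag_of (1, k)) = 0"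
        using tensor_relations_clear[OF M] by blast
      from this(1) this(2)[of 1] show ?thesis
        using tensor_clear_frag_of[of d 1 d scaleK k] tf[of d k] by simp
    qed
    then have "inj \<iota>"
      by (metis A.diff eq_iff_diff_eq_0 injI)
    moreover have "\<exists>s k. s \<noteq> 0 \<and> scaleFK (to_fract s) v = \<iota> k" for v
    proof -
      obtain p where p: "v = tensor_eval scaleFK \<iota> p"
        using L unfolding is_divisible_hull_def by blast
      obtain d k where d: "d \<noteq> 0" "p - frag_of (1 / to_fract d, k) \<in> tensor_relations scaleK"
        using tensor_relations_frag_of_fract[OF M] by blast
      then have "v = scaleFK (1 / to_fract d) (\<iota> k)"
        by (simp add: ker[symmetric] ev p)
      with d(1) have "scaleFK (to_fract d) v = \<iota> k" by simp
      with d(1) show ?thesis by blast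
    qed
    ultimately show ?R using add scale V.vector_space_axioms by blast
  }
  {
    assume R: ?R
    then interpret V: Vector_Spaces.vector_space scaleFK by simp
    have VM: "Modules.module scaleFK" ..
    note ev = tensor_eval_diff[OF VM] tensor_eval_frag_of
    have add: "\<And>k l. \<iota> (k + l) = \<iota> k + \<iota> l"
      and scale: "\<And>s k. \<iota> (scaleK s k) = scaleFK (to_fract s) (\<iota> k)"
      and "inj \<iota>" using R by auto
    interpret A: Modules.additive \<iota> by unfold_locales (rule add)
    have rel: "tensor_eval scaleFK \<iota> p = 0" if "p \<in> tensor_relations scaleK" for p
      using that by induction
        (simp_all add: ev tensor_eval_zero add scale V.scale_left_distrib V.scale_right_distrib)
    have "v \<in> range (tensor_eval scaleFK \<iota>)" for v
    proof -
      obtain s k where "s \<noteq> 0" "scaleFK (to_fract s) v = \<iota> k" using R by blast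
      then have "v = tensor_eval scaleFK \<iota> (frag_of (1 / to_fract s, k))"
        by (simp add: ev flip: \<open>scaleFK (to_fract s) v = \<iota> k\<close>)
      then show ?thesis by blast
    qed
    moreover have "p \<in> tensor_relations scaleK" if p: "tensor_eval scaleFK \<iota> p = 0" for p
    proof -
      obtain d k where d: "d \<noteq> 0" "p - frag_of (1 / to_fract d, k) \<in> tensor_relations scaleK"
        using tensor_relations_frag_of_fract[OF M] by blast
      then have "scaleFK (1 / to_fract d) (\<iota> k) = 0" using rel[OF d(2)] p by (simp add: ev)
      with d(1) have "\<iota> k = 0" by simp
      then have k: "k = 0" using \<open>inj \<iota>\<close> A.zero by (metis injD)
      have "0 - frag_of (1 / to_fract d, 0) \<in> tensor_relations scaleK"
        using tensor_relations.add_right[of "1 / to_fract d" 0 0 scaleK] by simp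
      from tensor_relations.diff[OF d(2) this] k show ?thesis by simp
    qed
    ultimately show ?L
      unfolding is_divisible_hull_def using rel V.vector_space_axioms by blast
  }
qed


subsection \<open>Strongly twisted subrings\<close>

definition derivation ::
    "('b::comm_ring_1 \<Rightarrow> 'l::ab_group_add \<Rightarrow> 'l) \<Rightarrow> ('b \<Rightarrow> 'l) \<Rightarrow> bool" where
  "derivation scaleL D \<longleftrightarrow>
     (\<forall>s t. D (s + t) = D s + D t) \<and>
     (\<forall>s t. D (s * t) = scaleL s (D t) + scaleL t (D s))"

definition strongly_twists ::
    "('s::idom fract \<Rightarrow> 'v::ab_group_add \<Rightarrow> 'v) \<Rightarrow> ('k \<Rightarrow> 'v) \<Rightarrow>
     ('s fract \<Rightarrow> 'v) \<Rightarrow> 's set \<Rightarrow> bool" where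
  "strongly_twists scaleFK \<iota> D R \<longleftrightarrow>
     subring R ring_of_type_algebra \<and>
     derivation scaleFK D \<and>
     R = {s. D (to_fract s) \<in> range \<iota>} \<and>
     Modules.module.span scaleFK (range D) = UNIV \<and>
     (\<forall>s. s \<noteq> 0 \<longrightarrow>
        range to_fract \<subseteq> {x. D x = 0} + range (\<lambda>t. to_fract (s * t)))"


subsection \<open>Finitely generated quotients\<close>

text \<open>
  $K/N$ is the set of cosets \<open>k +o N\<close>. Linear combinations in $K/N$ are formed on
  representatives, so the submodule of $K/N$ generated by the cosets of the elements of $A$
  consists of the cosets of the elements of the span of $A$.
\<close>

definition quotient_finitely_generated ::
    "('s::comm_ring_1 \<Rightarrow> 'k::ab_group_add \<Rightarrow> 'k) \<Rightarrow> 'k set \<Rightarrow> bool" where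
  "quotient_finitely_generated scaleK N \<longleftrightarrow>
     (\<exists>A. finite A \<and>
        (\<lambda>k. k +o N) ` Modules.module.span scaleK A = range (\<lambda>k. k +o N))"

end

theory Submission
  imports Defs
begin

text \<open>
  Let $A = S \cap \mathrm{Ker}\, D$. Condition (c) says $S = A + sS$ for every $s \ne 0$; hence every
  nonzero element of $S$ divides a nonzero element of $A$, and together with (b) one gets
  $FK = D(S) + K$. It follows that for $0 \ne a \in A$ the map $r \mapsto (r, D(r))$ induces a ring
  isomorphism from $R/aR$ onto the idealization of $K/aK$ over $S/aS$. Since every nonzero ideal of
  $R$ or $S$ contains such an $a$, finite generation of ideals passes between $R$ on the one hand
  and $S$, $K/aK$ on the other.
\<close>

section \<open>Noetherian subrings and modules\<close>

text \<open>Ideals of a subring are kept as plain sets in the ambient type. Negatives arise from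
  multiplication by \<open>- 1\<close>, an element of every subring \<open>R\<close>.\<close>

definition subring_ideal :: "'s::comm_ring_1 set \<Rightarrow> 's set \<Rightarrow> bool" where
  "subring_ideal R I \<longleftrightarrow> I \<subseteq> R \<and> 0 \<in> I \<and> (\<forall>x\<in>I. \<forall>y\<in>I. x + y \<in> I) \<and> (\<forall>r\<in>R. \<forall>x\<in>I. r * x \<in> I)"

text \<open>Finite generation is phrased by minimality: every ideal containing \<open>G\<close>
  contains \<open>I\<close>. To prove that all elements of \<open>I\<close> have a property, it then
  suffices to exhibit an ideal of such elements that contains \<open>G\<close>.\<close>

definition noetherian_subring :: "'s::comm_ring_1 set \<Rightarrow> bool" where
  "noetherian_subring R \<longleftrightarrow> (\<forall>I. subring_ideal R I \<longrightarrow>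
     (\<exists>G. finite G \<and> G \<subseteq> I \<and> (\<forall>J. subring_ideal R J \<longrightarrow> G \<subseteq> J \<longrightarrow> I \<subseteq> J)))"

lemma subring_idealI:
  assumes "I \<subseteq> R" "0 \<in> I" "\<And>x y. x \<in> I \<Longrightarrow> y \<in> I \<Longrightarrow> x + y \<in> I"
    and "\<And>r x. r \<in> R \<Longrightarrow> x \<in> I \<Longrightarrow> r * x \<in> I"
  shows "subring_ideal R I"
  using assms by (auto simp: subring_ideal_def)

lemma subring_idealD:
  assumes "subring_ideal R I"
  shows "I \<subseteq> R" "0 \<in> I" "x \<in> I \<Longrightarrow> y \<in> I \<Longrightarrow> x + y \<in> I" "r \<in> R \<Longrightarrow> x \<in> I \<Longrightarrow> r * x \<in> I"
  using assms by (auto simp: subring_ideal_def)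

lemma noetherian_subringE:
  assumes "noetherian_subring R" "subring_ideal R I"
  obtains G where "finite G" "G \<subseteq> I" "\<And>J. subring_ideal R J \<Longrightarrow> G \<subseteq> J \<Longrightarrow> I \<subseteq> J"
proof -
  from assms obtain G where "finite G" "G \<subseteq> I" "\<forall>J. subring_ideal R J \<longrightarrow> G \<subseteq> J \<longrightarrow> I \<subseteq> J"
    unfolding noetherian_subring_def by metis
  then show thesis by (intro that[of G]) simp_all
qed

lemma subring_ideal_Int:
  "subring_ideal R I \<Longrightarrow> subring_ideal R J \<Longrightarrow> subring_ideal R (I \<inter> J)"
  by (auto simp: subring_ideal_def)

lemma subring_of_typeD:
  fixes R :: "'s::comm_ring_1 set"
  assumes "subring R ring_of_type_algebra"
  shows "0 \<in> R" "1 \<in> R" "x \<in> R \<Longrightarrow> y \<in> R \<Longrightarrow> x + y \<in> R" "x \<in> R \<Longrightarrow> y \<in> R \<Longrightarrow> x * y \<in> R"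
    "x \<in> R \<Longrightarrow> - x \<in> R"
proof -
  note E = subringE[OF assms, simplified ring_of_type_algebra_def, simplified]
  show "0 \<in> R" "1 \<in> R" "x \<in> R \<Longrightarrow> y \<in> R \<Longrightarrow> x + y \<in> R" "x \<in> R \<Longrightarrow> y \<in> R \<Longrightarrow> x * y \<in> R" for x y
    using E by auto
  show "- x \<in> R" if "x \<in> R"
  proof -
    interpret ring "ring_of_type_algebra :: 's ring" ..
    have "\<ominus>\<^bsub>ring_of_type_algebra\<^esub> x = - x"
      by (rule minus_equality) (simp_all add: ring_of_type_algebra_def)
    with subringE(5)[OF assms that] show ?thesis by simp
  qed
qed

section \<open>Agreement with the ideals and Noetherian domains of HOL-Algebra\<close>

lemma ideal_iff_subring_ideal:
  fixes R :: "'s::comm_ring_1 set"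
  assumes R: "subring R ring_of_type_algebra"
  shows "ideal I (ring_of_type_algebra\<lparr>carrier := R\<rparr>) \<longleftrightarrow> subring_ideal R I" (is "ideal I ?R \<longleftrightarrow> _")
proof
  interpret T: ring "ring_of_type_algebra :: 's ring" ..
  interpret R: ring ?R by (rule T.subring_is_ring[OF R])
  {
    assume "ideal I ?R"
    then interpret ideal I ?R .
    show "subring_ideal R I"
    proof (rule subring_idealI)
      show "I \<subseteq> R" using a_subset by simp
      show "0 \<in> I" using zero_closed by (simp add: ring_of_type_algebra_def)
      show "x + y \<in> I" if "x \<in> I" "y \<in> I" for x y
        using a_closed[OF that] by (simp add: ring_of_type_algebra_def)
      show "r * x \<in> I" if "r \<in> R" "x \<in> I" for r x
        using I_l_closed[of x r] that by (simp add: ring_of_type_algebra_def)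
    qed
  next
    assume "subring_ideal R I"
    note I = subring_idealD[OF this]
    show "ideal I ?R"
    proof (rule idealI)
      show "ring ?R" ..
      show "subgroup I (add_monoid ?R)"
      proof (rule R.add.subgroupI)
        show "\<ominus>\<^bsub>?R\<^esub> x \<in> I" if "x \<in> I" for x
        proof -
          have "\<ominus>\<^bsub>?R\<^esub> x = - x"
            using that I(1) subring_of_typeD(5)[OF R]
            by (intro R.minus_equality) (auto simp: ring_of_type_algebra_def)
          \<comment> \<open>The additive inverse is the product with \<open>- 1\<close>, so closure
            under multiplication by \<open>R\<close> covers it.\<close>
          with I(4)[of "- 1" x] that subring_of_typeD(2,5)[OF R] show ?thesis by simp
        qed
      qed (use I in \<open>auto simp: ring_of_type_algebra_def\<close>)
      fix a x assume "a \<in> I" "x \<in> carrier ?R"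
      then have "x * a \<in> I" using I(4) by simp
      then show "x \<otimes>\<^bsub>?R\<^esub> a \<in> I" "a \<otimes>\<^bsub>?R\<^esub> x \<in> I"
        by (simp_all add: ring_of_type_algebra_def mult.commute)
    qed
  }
qed

text \<open>The domain property is inherited from the class \<open>idom\<close>, so only finite
  generation has to be compared. There \<open>genideal\<close> is the least ideal containing
  \<open>G\<close>, which matches the minimality formulation.\<close>

lemma noetherian_domain_iff:
  fixes R :: "'s::idom set"
  assumes R: "subring R ring_of_type_algebra"
  shows "noetherian_domain (ring_of_type_algebra\<lparr>carrier := R\<rparr>) \<longleftrightarrow> noetherian_subring R"
    (is "noetherian_domain ?R \<longleftrightarrow> _")
proof
  interpret T: ring "ring_of_type_algebra :: 's ring" ..
  interpret R: ring ?R by (rule T.subring_is_ring[OF R])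
  note id = ideal_iff_subring_ideal[OF R]
  {
    assume "noetherian_domain ?R"
    then interpret noetherian_domain ?R .
    show "noetherian_subring R"
      unfolding noetherian_subring_def id[symmetric]
    proof (intro allI impI)
      fix I assume "ideal I ?R"
      then obtain G where "G \<subseteq> carrier ?R" "finite G" "I = Idl\<^bsub>?R\<^esub> G"
        using finetely_gen by blast
      then show "\<exists>G. finite G \<and> G \<subseteq> I \<and> (\<forall>J. ideal J ?R \<longrightarrow> G \<subseteq> J \<longrightarrow> I \<subseteq> J)"
        using R.genideal_self R.genideal_minimal by metis
    qed
  next
    assume N: "noetherian_subring R"
    have "noetherian_ring ?R"
    proof (rule R.noetherian_ringI)
      fix I assume I: "ideal I ?R"
      then obtain G where G: "finite G" "G \<subseteq> I" "\<And>J. ideal J ?R \<Longrightarrow> G \<subseteq> J \<Longrightarrow> I \<subseteq> J"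
        using N unfolding noetherian_subring_def id[symmetric] by metis
      have carr: "G \<subseteq> carrier ?R" using G(2) I by (auto simp: id subring_ideal_def)
      then have "I = Idl\<^bsub>?R\<^esub> G"
        using R.genideal_minimal[OF I G(2)] G(3)[OF R.genideal_ideal R.genideal_self] by blast
      with carr G(1) show "\<exists>G\<subseteq>carrier ?R. finite G \<and> I = Idl\<^bsub>?R\<^esub> G" by blast
    qed
    moreover have "domain ?R"
      by unfold_locales (auto simp: ring_of_type_algebra_def)
    ultimately show "noetherian_domain ?R"
      by (simp add: noetherian_domain_def)
  }
qed

section \<open>Submodules and quotients over a Noetherian ring\<close>

context Modules.module
begin

text \<open>The classical induction on the number of generators, carried out relative to
  \<open>P\<close> so that no quotient module has to be formed. It will be applied with aK for
  \<open>P\<close>.\<close>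

lemma noetherian_submodule:
  assumes "noetherian_subring (UNIV :: 'a set)" and "finite A"
    and "subspace N" "P \<subseteq> N" "N \<subseteq> span (A \<union> P)"
  shows "\<exists>B. finite B \<and> B \<subseteq> N \<and> N \<subseteq> span (B \<union> P)"
  using assms(2-)
proof (induction A arbitrary: N)
  case empty
  then show ?case by (intro exI[of _ "{}"]) auto
next
  case (insert x A)
  let ?W = "span (A \<union> P)"
  note N = insert.prems(1)
  have W: "subspace ?W" by simp
  obtain B where B: "finite B" "B \<subseteq> N \<inter> ?W" "N \<inter> ?W \<subseteq> span (B \<union> P)"
    using insert.IH[of "N \<inter> ?W"] subspace_inter[OF N W] insert.prems(2)
      span_superset[of "A \<union> P"] by auto
  \<comment> \<open>The possible coefficients of \<open>x\<close>, modulo \<open>?W\<close>, of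
    elements of \<open>N\<close>. They form an ideal, whose finitely many generators are lifted to
    elements \<open>n g\<close> of \<open>N\<close>.\<close>
  let ?I = "{s. \<exists>n\<in>N. n - s *s x \<in> ?W}"
  have "subring_ideal UNIV ?I"
  proof (rule subring_idealI, simp_all)
    show "\<exists>n\<in>N. n \<in> ?W" using subspace_0[OF N] span_zero by blast
    show "\<exists>n\<in>N. n - (s + t) *s x \<in> ?W"
      if "\<exists>n\<in>N. n - s *s x \<in> ?W" "\<exists>n\<in>N. n - t *s x \<in> ?W" for s t
    proof -
      from that obtain m n where "m \<in> N" "n \<in> N" "m - s *s x \<in> ?W" "n - t *s x \<in> ?W" by blast
      then show ?thesis
        using span_add[of "m - s *s x" _ "n - t *s x"] subspace_add[OF N]
        by (intro bexI[of _ "m + n"]) (auto simp: algebra_simps scale_left_distrib)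
    qed
    show "\<exists>n\<in>N. n - (r * s) *s x \<in> ?W" if "\<exists>n\<in>N. n - s *s x \<in> ?W" for r s
    proof -
      from that obtain n where "n \<in> N" "n - s *s x \<in> ?W" by blast
      then show ?thesis
        using span_scale[of "n - s *s x" _ r] subspace_scale[OF N]
        by (intro bexI[of _ "r *s n"]) (auto simp: scale_right_diff_distrib)
    qed
  qed
  then obtain G where G: "finite G" "G \<subseteq> ?I" "\<And>J. subring_ideal UNIV J \<Longrightarrow> G \<subseteq> J \<Longrightarrow> ?I \<subseteq> J"
    by (rule noetherian_subringE[OF assms(1)]) (rule that)
  have "\<forall>g\<in>G. \<exists>n. n \<in> N \<and> n - g *s x \<in> ?W" using G(2) by blast
  from bchoice[OF this] obtain n where n: "\<And>g. g \<in> G \<Longrightarrow> n g \<in> N \<and> n g - g *s x \<in> ?W"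
    by blast
  \<comment> \<open>The coefficients already attained by combinations of the lifts. This ideal
    contains \<open>G\<close>, hence all of \<open>?I\<close>.\<close>
  let ?J = "{s. \<exists>m\<in>span (n ` G). m - s *s x \<in> ?W}"
  have "subring_ideal UNIV ?J"
  proof (rule subring_idealI, simp_all)
    show "\<exists>m\<in>span (n ` G). m \<in> ?W" using span_zero by blast
    show "\<exists>m\<in>span (n ` G). m - (s + t) *s x \<in> ?W"
      if "\<exists>m\<in>span (n ` G). m - s *s x \<in> ?W" "\<exists>m\<in>span (n ` G). m - t *s x \<in> ?W" for s t
    proof -
      from that obtain m l where "m \<in> span (n ` G)" "l \<in> span (n ` G)"
        "m - s *s x \<in> ?W" "l - t *s x \<in> ?W" by blast
      then show ?thesis
        using span_add[of "m - s *s x" _ "l - t *s x"] span_add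
        by (intro bexI[of _ "m + l"]) (auto simp: algebra_simps scale_left_distrib)
    qed
    show "\<exists>m\<in>span (n ` G). m - (r * s) *s x \<in> ?W" if "\<exists>m\<in>span (n ` G). m - s *s x \<in> ?W" for r s
    proof -
      from that obtain m where "m \<in> span (n ` G)" "m - s *s x \<in> ?W" by blast
      then show ?thesis
        using span_scale[of "m - s *s x" _ r] span_scale
        by (intro bexI[of _ "r *s m"]) (auto simp: scale_right_diff_distrib)
    qed
  qed
  moreover have "G \<subseteq> ?J" using n span_base[of "n _" "n ` G"] by blast
  ultimately have IJ: "?I \<subseteq> ?J" by (rule G(3))
  have "n ` G \<subseteq> N" using n by blast
  then have nG: "span (n ` G) \<subseteq> N" using N by (rule span_minimal)
  have "y \<in> span (B \<union> n ` G \<union> P)" if y: "y \<in> N" for y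
  proof -
    obtain s where s: "y - s *s x \<in> ?W"
      using y insert.prems(3) span_breakdown_eq[of y x "A \<union> P"] by auto
    \<comment> \<open>Since \<open>m\<close> has the same coefficient of \<open>x\<close> as
      \<open>y\<close>, the difference falls into the intersection of \<open>N\<close> and
      \<open>?W\<close>, which the induction hypothesis handles.\<close>
    with y IJ obtain m where m: "m \<in> span (n ` G)" "m - s *s x \<in> ?W" by blast
    have "y - m \<in> ?W" using span_diff[OF s m(2)] by simp
    moreover have "y - m \<in> N" using subspace_diff[OF N y] m(1) nG by blast
    ultimately have "y - m \<in> span (B \<union> P)" using B(3) by blast
    then have "y - m \<in> span (B \<union> n ` G \<union> P)"
      using span_mono[of "B \<union> P" "B \<union> n ` G \<union> P"] by blast
    moreover have "m \<in> span (B \<union> n ` G \<union> P)"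
      using span_mono[of "n ` G" "B \<union> n ` G \<union> P"] m(1) by blast
    ultimately have "y - m + m \<in> span (B \<union> n ` G \<union> P)" by (rule span_add)
    then show ?thesis by simp
  qed
  then show ?case
    using B(1,2) G(1) \<open>n ` G \<subseteq> N\<close> by (intro exI[of _ "B \<union> n ` G"]) auto
qed

text \<open>Two cosets agree exactly when their representatives differ by an element of
  \<open>N\<close>; this replaces coset sets by congruences modulo \<open>N\<close>.\<close>

lemma quotient_finitely_generated_iff:
  assumes N: "subspace N"
  shows "quotient_finitely_generated scale N \<longleftrightarrow>
    (\<exists>A. finite A \<and> (\<forall>k. \<exists>t\<in>span A. k - t \<in> N))"
proof -
  have coset: "k +o N = t +o N \<longleftrightarrow> k - t \<in> N" for k t
  proof
    assume "k +o N = t +o N"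
    moreover have "k \<in> k +o N" using subspace_0[OF N] by (force simp: elt_set_plus_def)
    ultimately show "k - t \<in> N" by (auto simp: elt_set_plus_def)
  next
    assume d: "k - t \<in> N"
    have "x \<in> k +o N \<longleftrightarrow> x \<in> t +o N" for x
    proof -
      have "x \<in> k +o N \<longleftrightarrow> x - k \<in> N" "x \<in> t +o N \<longleftrightarrow> x - t \<in> N"
        by (auto simp: elt_set_plus_def intro: bexI[of _ "x - _"])
      then show ?thesis
        using subspace_add[OF N _ d, of "x - k"] subspace_diff[OF N _ d, of "x - t"] by auto
    qed
    then show "k +o N = t +o N" by blast
  qed
  have "(\<lambda>k. k +o N) ` span A = range (\<lambda>k. k +o N) \<longleftrightarrow> (\<forall>k. \<exists>t\<in>span A. k - t \<in> N)" for A
    by (auto simp: coset[symmetric] image_iff set_eq_iff[of "_ ` _"])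
  then show ?thesis unfolding quotient_finitely_generated_def by simp
qed

lemma subspace_range_scale: "subspace (range (scale a))"
proof -
  interpret module_hom scale scale "scale a"
    by unfold_locales (simp_all add: scale_right_distrib mult.commute)
  show ?thesis using subspace_image[OF subspace_UNIV] .
qed

end

section \<open>Strongly twisted subrings\<close>

locale strong_twist =
  fixes scaleK :: "'s::idom \<Rightarrow> 'k::ab_group_add \<Rightarrow> 'k"
    and scaleFK :: "'s fract \<Rightarrow> 'v::ab_group_add \<Rightarrow> 'v"
    and \<iota> :: "'k \<Rightarrow> 'v"
    and D :: "'s fract \<Rightarrow> 'v"
    and R :: "'s set"
  assumes torsion_free: "torsion_free_module scaleK"
    and hull: "is_divisible_hull scaleK scaleFK \<iota>"
    and twists: "strongly_twists scaleFK \<iota> D R"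
begin

sublocale K: Modules.module scaleK
  using torsion_free by (simp add: torsion_free_module_def)

sublocale V: Vector_Spaces.vector_space scaleFK
  using hull by (simp add: is_divisible_hull_def)

abbreviation \<delta> :: "'s \<Rightarrow> 'v" where "\<delta> s \<equiv> D (to_fract s)"

abbreviation smult :: "'s \<Rightarrow> 'v \<Rightarrow> 'v" (infixr "\<cdot>" 75) where
  "s \<cdot> v \<equiv> scaleFK (to_fract s) v"

lemma iota_add: "\<iota> (k + l) = \<iota> k + \<iota> l"
  and iota_scale: "\<iota> (scaleK s k) = s \<cdot> \<iota> k"
  and inj_iota: "inj \<iota>"
  and hull_cases: "\<exists>s k. s \<noteq> 0 \<and> s \<cdot> v = \<iota> k"
  using hull unfolding is_divisible_hull_iff[OF torsion_free] by auto

sublocale iota: Modules.additive \<iota>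
  by unfold_locales (rule iota_add)

lemma D_add: "D (x + y) = D x + D y"
  and D_mult: "D (x * y) = scaleFK x (D y) + scaleFK y (D x)"
  using twists by (auto simp: strongly_twists_def derivation_def)

sublocale D: Modules.additive D
  by unfold_locales (rule D_add)

lemma D_1: "D 1 = 0"
  using D_mult[of 1 1] by simp

lemma smult_cancel: "s \<noteq> 0 \<Longrightarrow> s \<cdot> v = s \<cdot> w \<longleftrightarrow> v = w"
  by simp

lemma subring_R: "subring R ring_of_type_algebra"
  and R_iff: "s \<in> R \<longleftrightarrow> (\<exists>k. \<delta> s = \<iota> k)"
  and span_D: "V.span (range D) = UNIV"
  using twists by (auto simp: strongly_twists_def)

lemmas R_closed = subring_of_typeD[OF subring_R]

section \<open>Constants, that is, elements of S killed by \<open>D\<close>\<close>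

lemma const_in_R: "\<delta> \<alpha> = 0 \<Longrightarrow> \<alpha> \<in> R"
  using iota.zero by (metis R_iff)

text \<open>Condition (c) read elementwise. It supplies a constant in F, which lies in S because it
  is a difference of two elements of S.\<close>

lemma const_decomp:
  assumes "s \<noteq> 0"
  obtains \<alpha> t where "\<delta> \<alpha> = 0" "x = \<alpha> + s * t"
proof -
  have "to_fract x \<in> {y. D y = 0} + range (\<lambda>t. to_fract (s * t))"
    using twists assms unfolding strongly_twists_def by blast
  then obtain y t where y: "D y = 0" "to_fract x = y + to_fract (s * t)"
    by (auto simp: set_plus_def)
  then have "y = to_fract (x - s * t)" by (simp add: algebra_simps)
  with y(1) that[of "x - s * t" t] show ?thesis by simp
qed

text \<open>Writing $s = \alpha + s^2 t$, either $\alpha = s(1 - st)$ is nonzero or $s$ is a unit.\<close>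

lemma const_multiple:
  assumes "s \<noteq> 0"
  obtains t where "s * t \<noteq> 0" "\<delta> (s * t) = 0"
proof -
  obtain \<alpha> t where \<alpha>: "\<delta> \<alpha> = 0" "s = \<alpha> + (s * s) * t"
    using const_decomp[of "s * s" s] assms by auto
  show thesis
  proof (cases "\<alpha> = 0")
    case True
    with \<alpha>(2) have "s * (s * t) = s * 1" by (simp add: ac_simps)
    with assms have "s * t = 1" by (simp only: mult_cancel_left) simp
    with that[of t] D_1 show thesis by simp
  next
    case False
    have "s * (1 - s * t) = \<alpha>" using \<alpha>(2) by (simp add: algebra_simps)
    with False \<alpha>(1) that show thesis by metis
  qed
qed

text \<open>Any denominator has a nonzero constant multiple, and that multiple still clears.\<close>

lemma const_clears:
  obtains c k where "c \<noteq> 0" "\<delta> c = 0" "c \<cdot> v = \<iota> k"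
proof -
  obtain s k where s: "s \<noteq> 0" "s \<cdot> v = \<iota> k" using hull_cases by blast
  obtain t where t: "s * t \<noteq> 0" "\<delta> (s * t) = 0" using const_multiple[OF s(1)] .
  have "(s * t) \<cdot> v = t \<cdot> (s \<cdot> v)" by (simp add: mult.commute)
  then have "(s * t) \<cdot> v = \<iota> (scaleK t k)" by (simp only: s(2) iota_scale)
  with t that show thesis by blast
qed

lemma const_denominator:
  obtains c s where "c \<noteq> 0" "\<delta> c = 0" "to_fract c * x = to_fract s"
proof -
  obtain d u where d: "d \<noteq> 0" "to_fract d * x = to_fract u" using fract_denominator[of x] by blast
  obtain t where t: "d * t \<noteq> 0" "\<delta> (d * t) = 0" using const_multiple[OF d(1)] .
  have "to_fract (d * t) * x = to_fract (t * u)" using d(2) by (simp add: ac_simps)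
  with t that show thesis by blast
qed

section \<open>The decomposition FK = D(S) + K\<close>

lemma D_const_mult: "\<delta> \<alpha> = 0 \<Longrightarrow> D (to_fract \<alpha> * y) = \<alpha> \<cdot> D y"
  by (simp add: D_mult)

lemma delta_mult: "\<delta> (s * t) = s \<cdot> \<delta> t + t \<cdot> \<delta> s"
  by (simp add: D_mult)

lemma delta_const_mult: "\<delta> \<alpha> = 0 \<Longrightarrow> \<delta> (\<alpha> * t) = \<alpha> \<cdot> \<delta> t"
  by (simp add: D_mult)

text \<open>With constant denominators, \<open>scaleFK x (D y)\<close> becomes (t/b)
  \<open>\<delta> s\<close> for a constant b. Splitting t and s by condition (c) separates this into
  a value of \<open>\<delta>\<close> and an element of K.\<close>

lemma scale_D_decomp: "\<exists>s k. scaleFK x (D y) = \<delta> s + \<iota> k"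
proof -
  obtain c s where c: "c \<noteq> 0" "\<delta> c = 0" "to_fract c * y = to_fract s"
    by (rule const_denominator)
  obtain b t where b: "b \<noteq> 0" "\<delta> b = 0" "to_fract b * (x / to_fract c) = to_fract t"
    by (rule const_denominator)
  obtain e k where e: "e \<noteq> 0" "\<delta> e = 0" "e \<cdot> \<delta> s = \<iota> k"
    by (rule const_clears)
  have cy: "c \<cdot> D y = \<delta> s" using D_const_mult[OF c(2), of y] c(3) by simp
  have x: "x = (to_fract t / to_fract b) * to_fract c" using b(1,3) c(1) by (simp add: field_simps)
  have xDy: "b \<cdot> scaleFK x (D y) = t \<cdot> \<delta> s"
    using b(1) by (simp add: x cy[symmetric])
  \<comment> \<open>The modulus contains \<open>e\<close> so that the non-constant part of
    \<open>t\<close> carries \<open>\<delta> s\<close> into K, and \<open>b\<close> so that this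
    part remains divisible by \<open>b\<close>.\<close>
  obtain \<alpha> t' where \<alpha>: "\<delta> \<alpha> = 0" "t = \<alpha> + (b * e) * t'"
    using const_decomp[of "b * e" t] b(1) e(1) by auto
  \<comment> \<open>Up to a constant, \<open>s\<close> is a multiple of \<open>b\<close>. As
    \<open>b\<close> is itself constant, \<open>\<delta> s\<close> is \<open>b\<close> times a value
    of \<open>\<delta>\<close>, and the denominator cancels.\<close>
  obtain \<beta> s' where \<beta>: "\<delta> \<beta> = 0" "s = \<beta> + b * s'"
    using const_decomp[OF b(1), of s] .
  have s': "\<delta> s = b \<cdot> \<delta> s'" unfolding \<beta>(2) by (simp add: D_add \<beta>(1) D_mult b(2))
  have "t \<cdot> \<delta> s = \<alpha> \<cdot> \<delta> s + (b * t') \<cdot> (e \<cdot> \<delta> s)"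
    unfolding \<alpha>(2) by (simp add: V.scale_left_distrib ac_simps)
  also have "(b * t') \<cdot> (e \<cdot> \<delta> s) = b \<cdot> \<iota> (scaleK t' k)"
    by (simp only: e(3) iota_scale) simp
  also have "\<alpha> \<cdot> \<delta> s = b \<cdot> \<delta> (\<alpha> * s')"
    by (simp only: s' delta_const_mult[OF \<alpha>(1)]) (simp add: mult.commute)
  also have "b \<cdot> \<delta> (\<alpha> * s') + b \<cdot> \<iota> (scaleK t' k) = b \<cdot> (\<delta> (\<alpha> * s') + \<iota> (scaleK t' k))"
    by (simp only: V.scale_right_distrib)
  finally have "b \<cdot> scaleFK x (D y) = b \<cdot> (\<delta> (\<alpha> * s') + \<iota> (scaleK t' k))"
    using xDy by simp
  then have "scaleFK x (D y) = \<delta> (\<alpha> * s') + \<iota> (scaleK t' k)"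
    by (simp only: smult_cancel[OF b(1)])
  then show ?thesis by blast
qed

text \<open>By condition (b) every vector is a sum of terms \<open>scaleFK x (D y)\<close>. Each
  such term has the required form, and the form is preserved under addition.\<close>

lemma delta_plus_iota:
  obtains s k where "v = \<delta> s + \<iota> k"
proof -
  have "v \<in> V.span (range D)" by (simp add: span_D)
  then have "\<exists>s k. v = \<delta> s + \<iota> k"
  proof (induction rule: V.span_induct_alt)
    case base
    show ?case using D.zero iota.zero by (metis add_0 to_fract_0)
  next
    case (step x w v)
    then obtain y s k where "w = D y" "v = \<delta> s + \<iota> k" by blast
    moreover obtain s' k' where "scaleFK x (D y) = \<delta> s' + \<iota> k'" using scale_D_decomp by blast
    ultimately have "scaleFK x w + v = \<delta> (s' + s) + \<iota> (k' + k)"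
      by (simp add: D_add iota_add)
    then show ?case by blast
  qed
  with that show thesis by blast
qed

text \<open>A constant multiple \<open>r * t\<close> need not lie in \<open>I\<close>, since
  \<open>t\<close> may lie outside \<open>R\<close>. A further constant factor \<open>e\<close> that
  moves \<open>\<delta> t\<close> into K brings \<open>e * t\<close> into \<open>R\<close>.\<close>

lemma nonzero_ideal_const:
  assumes I: "subring_ideal R I" and r: "r \<in> I" "r \<noteq> 0"
  obtains a where "a \<in> I" "a \<noteq> 0" "\<delta> a = 0"
proof -
  obtain t where t: "r * t \<noteq> 0" "\<delta> (r * t) = 0" using const_multiple[OF r(2)] .
  obtain e k where e: "e \<noteq> 0" "\<delta> e = 0" "e \<cdot> \<delta> t = \<iota> k" by (rule const_clears)
  have "e * t \<in> R" using e by (auto simp: R_iff D_mult)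
  then have "(e * t) * r \<in> I" using subring_idealD(4)[OF I] r(1) by blast
  moreover have "\<delta> ((e * t) * r) = 0"
    using delta_const_mult[OF e(2), of "r * t"] t(2) by (simp add: ac_simps)
  moreover have "(e * t) * r \<noteq> 0" using e(1) t(1) by auto
  ultimately show thesis using that by blast
qed

section \<open>From \<open>R\<close> to S and the quotients K/aK\<close>

text \<open>Every ideal of S is generated by its elements in \<open>R\<close>, so generators of the
  contraction to \<open>R\<close> also generate the ideal over S.\<close>

lemma noetherian_overring:
  assumes N: "noetherian_subring R"
  shows "noetherian_subring (UNIV :: 's set)"
  unfolding noetherian_subring_def
proof (intro allI impI)
  fix I :: "'s set" assume "subring_ideal UNIV I"
  note I = subring_idealD[OF this]
  have "subring_ideal R (I \<inter> R)"
    by (rule subring_idealI) (use I R_closed in auto)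
  then obtain G where G: "finite G" "G \<subseteq> I \<inter> R"
    "\<And>J. subring_ideal R J \<Longrightarrow> G \<subseteq> J \<Longrightarrow> I \<inter> R \<subseteq> J"
    by (rule noetherian_subringE[OF N]) (rule that)
  have "I \<subseteq> J" if "subring_ideal UNIV J" "G \<subseteq> J" for J
  proof
    note J = subring_idealD[OF that(1)]
    fix x assume x: "x \<in> I"
    have "subring_ideal R (J \<inter> R)"
      by (rule subring_idealI) (use J R_closed in auto)
    with G(2) that(2) have IJ: "I \<inter> R \<subseteq> J" using G(3)[of "J \<inter> R"] by blast
    show "x \<in> J"
    proof (cases "x = 0")
      case True
      with J(2) show ?thesis by simp
    next
      case False
      obtain t where t: "x * t \<noteq> 0" "\<delta> (x * t) = 0" using const_multiple[OF False] .
      have a: "t * x \<in> I" using I(4) x by simp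
      then have aJ: "t * x \<in> J" using IJ const_in_R[OF t(2)] by (auto simp: mult.commute)
      \<comment> \<open>Division by the constant multiple \<open>x * t\<close>, itself in
        \<open>I\<close>, leaves a constant remainder in \<open>I\<close>. Both constants lie in
        \<open>R\<close>, hence in \<open>J\<close>, and together they produce
        \<open>x\<close>.\<close>
      obtain \<alpha> u where \<alpha>: "\<delta> \<alpha> = 0" "x = \<alpha> + (x * t) * u" using const_decomp[OF t(1)] .
      have "\<alpha> = x + (- u) * (t * x)" using \<alpha>(2) by (simp add: algebra_simps)
      then have "\<alpha> \<in> I" using I(3)[OF x I(4)[OF _ a, of "- u"]] by simp
      then have "\<alpha> \<in> J" using IJ const_in_R[OF \<alpha>(1)] by blast
      then have "\<alpha> + u * (t * x) \<in> J" using J(3,4) aJ by blast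
      moreover have "\<alpha> + u * (t * x) = x" using \<alpha>(2) by (simp add: ac_simps)
      ultimately show ?thesis by simp
    qed
  qed
  with G(1,2) show "\<exists>G. finite G \<and> G \<subseteq> I \<and> (\<forall>J. subring_ideal UNIV J \<longrightarrow> G \<subseteq> J \<longrightarrow> I \<subseteq> J)"
    by blast
qed

text \<open>Modulo aK, \<open>\<delta>\<close> is an \<open>R\<close>-linear map from the ideal of
  multiples of \<open>a\<close> in \<open>R\<close> onto K/aK. The images of ideal generators
  therefore generate K/aK.\<close>

lemma quotient_finitely_generated_of_noetherian:
  assumes N: "noetherian_subring R" and a: "a \<noteq> 0" "\<delta> a = 0"
  shows "quotient_finitely_generated scaleK (range (scaleK a))"
proof -
  let ?J = "R \<inter> range ((*) a)"
  have "subring_ideal R ?J"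
  proof (rule subring_idealI)
    show "0 \<in> ?J" using R_closed(1) by (auto intro: image_eqI[of _ _ 0])
    show "x + y \<in> ?J" if "x \<in> ?J" "y \<in> ?J" for x y
      using that R_closed(3) by (auto simp flip: distrib_left)
    show "r * x \<in> ?J" if "r \<in> R" "x \<in> ?J" for r x
      using that R_closed(4) by (auto simp: mult.left_commute)
  qed simp
  then obtain G where G: "finite G" "G \<subseteq> ?J" "\<And>J. subring_ideal R J \<Longrightarrow> G \<subseteq> J \<Longrightarrow> ?J \<subseteq> J"
    by (rule noetherian_subringE[OF N]) (rule that)
  \<comment> \<open>The element of K that represents \<open>\<delta> r\<close>; meaningful for
    \<open>r\<close> in \<open>R\<close>.\<close>
  define \<kappa> where "\<kappa> r = inv_into UNIV \<iota> (\<delta> r)" for r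
  have \<kappa>: "\<iota> (\<kappa> r) = \<delta> r" if "r \<in> R" for r
    unfolding \<kappa>_def by (rule f_inv_into_f) (use that R_iff in auto)
  \<comment> \<open>The elements whose derivative is, modulo aK, in the span of the images of
    \<open>G\<close>. Once this is an ideal containing \<open>G\<close>, it is all of
    \<open>?J\<close>.\<close>
  let ?L = "{r \<in> ?J. \<exists>t\<in>K.span (\<kappa> ` G). \<exists>l. \<delta> r = \<iota> t + \<iota> (scaleK a l)}"
  have "subring_ideal R ?L"
  proof (rule subring_idealI)
    note J = subring_idealD[OF \<open>subring_ideal R ?J\<close>]
    show "0 \<in> ?L"
      using J(2) K.span_zero by (auto simp: D.zero iota.zero intro!: bexI[of _ 0] exI[of _ 0])
    fix x assume "x \<in> ?L"
    then obtain t l where x: "x \<in> ?J" "t \<in> K.span (\<kappa> ` G)" "\<delta> x = \<iota> t + \<iota> (scaleK a l)" by blast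
    {
      fix y assume "y \<in> ?L"
      then obtain t' l' where y: "y \<in> ?J" "t' \<in> K.span (\<kappa> ` G)" "\<delta> y = \<iota> t' + \<iota> (scaleK a l')"
        by blast
      have "\<delta> (x + y) = \<iota> (t + t') + \<iota> (scaleK a (l + l'))"
        by (simp add: D_add x(3) y(3) iota_add K.scale_right_distrib V.scale_right_distrib)
      with J(3)[OF x(1) y(1)] K.span_add[OF x(2) y(2)] show "x + y \<in> ?L" by blast
    next
      fix r assume r: "r \<in> R"
      obtain s where s: "x = a * s" using x(1) by blast
      obtain k where k: "\<delta> r = \<iota> k" using r R_iff by blast
      \<comment> \<open>Linearity modulo aK: the extra term of the product rule is divisible by
        \<open>a\<close>, because \<open>x = a * s\<close> and \<open>\<delta> r\<close> lies in
        K.\<close>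
      have "\<delta> (r * x) = r \<cdot> \<delta> x + a \<cdot> (s \<cdot> \<iota> k)"
        unfolding delta_mult k by (simp add: s)
      also have "\<dots> = \<iota> (scaleK r t) + \<iota> (scaleK a (scaleK r l + scaleK s k))"
        unfolding x(3) iota_scale iota_add by (simp add: V.scale_right_distrib mult.commute)
      finally show "r * x \<in> ?L"
        using J(4)[OF r x(1)] K.span_scale[OF x(2), of r] by blast
    }
  qed blast
  moreover have "G \<subseteq> ?L"
  proof
    fix g assume g: "g \<in> G"
    then have "\<delta> g = \<iota> (\<kappa> g) + \<iota> (scaleK a 0)" using G(2) \<kappa>[of g] by (auto simp: iota.zero)
    moreover have "\<kappa> g \<in> K.span (\<kappa> ` G)" using g by (simp add: K.span_base)
    ultimately show "g \<in> ?L" using g G(2) by blast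
  qed
  ultimately have L: "?J \<subseteq> ?L" by (rule G(3))
  have "\<exists>t\<in>K.span (\<kappa> ` G). k - t \<in> range (scaleK a)" for k
  proof -
    \<comment> \<open>Surjectivity: decompose k/a in FK and multiply back by \<open>a\<close>, which
      passes inside \<open>\<delta>\<close> because it is constant.\<close>
    obtain s k' where "scaleFK (1 / to_fract a) (\<iota> k) = \<delta> s + \<iota> k'" by (rule delta_plus_iota)
    then have "a \<cdot> scaleFK (1 / to_fract a) (\<iota> k) = a \<cdot> (\<delta> s + \<iota> k')" by simp
    then have k: "\<iota> k = \<delta> (a * s) + \<iota> (scaleK a k')"
      using a by (simp add: V.scale_right_distrib D_mult iota_scale)
    then have "\<delta> (a * s) = \<iota> (k - scaleK a k')" by (simp add: iota.diff)
    then have "a * s \<in> ?J" using R_iff by auto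
    then obtain t l where t: "t \<in> K.span (\<kappa> ` G)" "\<delta> (a * s) = \<iota> t + \<iota> (scaleK a l)"
      using L by blast
    from k t(2) have "\<iota> k = \<iota> (t + scaleK a (l + k'))"
      by (simp add: iota_add K.scale_right_distrib)
    then have "k - t = scaleK a (l + k')" using inj_iota by (simp add: inj_eq)
    with t(1) show ?thesis by blast
  qed
  moreover have "finite (\<kappa> ` G)" using G(1) by simp
  ultimately show ?thesis
    unfolding K.quotient_finitely_generated_iff[OF K.subspace_range_scale] by blast
qed

section \<open>From S and the quotients K/aK back to \<open>R\<close>\<close>

text \<open>A scalar of S is a constant, hence an element of \<open>R\<close>, plus a multiple of
  \<open>a\<close>. The constant preserves \<open>J\<close> and the rest lands in aS. The set is J +
  aS, the first component of \<open>J\<close> in the idealization.\<close>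

lemma ideal_plus_principal:
  assumes J: "subring_ideal R J" and a: "a \<in> J" "a \<noteq> 0" "\<delta> a = 0"
  shows "subring_ideal UNIV {s. \<exists>j\<in>J. \<exists>t. s = j + a * t}" (is "subring_ideal UNIV ?S")
proof (rule subring_idealI)
  note J = subring_idealD[OF J]
  show "0 \<in> ?S" using J(2) by (auto intro!: bexI[of _ 0] exI[of _ 0])
  fix x assume "x \<in> ?S"
  then obtain j t where x: "j \<in> J" "x = j + a * t" by blast
  {
    fix y assume "y \<in> ?S"
    then obtain i u where y: "i \<in> J" "y = i + a * u" by blast
    have "x + y = (j + i) + a * (t + u)" using x y by (simp add: algebra_simps)
    with J(3)[OF x(1) y(1)] show "x + y \<in> ?S" by blast
  next
    fix s
    obtain \<alpha> u where \<alpha>: "\<delta> \<alpha> = 0" "s = \<alpha> + a * u" using const_decomp[OF a(2)] .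
    have "s * x = \<alpha> * j + a * (u * j + s * t)" unfolding x(2) \<alpha>(2) by (simp add: algebra_simps)
    with J(4)[OF const_in_R[OF \<alpha>(1)] x(1)] show "s * x \<in> ?S" by blast
  }
qed simp

text \<open>The set represents the second component in K/aK of those elements of \<open>J\<close>
  whose first component vanishes in S/aS. Scalars are again split into a constant and a multiple of
  \<open>a\<close>; the latter contributes only to aK, since \<open>\<delta> j\<close> lies in
  K.\<close>

lemma subspace_delta_ideal:
  assumes J: "subring_ideal R J" and a: "a \<noteq> 0" "\<delta> a = 0"
  shows "K.subspace {k. \<exists>j\<in>J. \<exists>s l. j = a * s \<and> \<iota> k = \<delta> j + a \<cdot> \<iota> l}" (is "K.subspace ?N")
  unfolding K.subspace_def
proof (intro conjI ballI allI)
  note J = subring_idealD[OF J]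
  show "0 \<in> ?N"
    using J(2) by (auto simp: D.zero iota.zero intro!: bexI[of _ 0] exI[of _ 0])
  fix k assume "k \<in> ?N"
  then obtain j s l where k: "j \<in> J" "j = a * s" "\<iota> k = \<delta> j + a \<cdot> \<iota> l" by blast
  {
    fix k' assume "k' \<in> ?N"
    then obtain j' s' l' where k': "j' \<in> J" "j' = a * s'" "\<iota> k' = \<delta> j' + a \<cdot> \<iota> l'" by blast
    have "\<iota> (k + k') = \<delta> (j + j') + a \<cdot> \<iota> (l + l')"
      by (simp add: iota_add k(3) k'(3) D_add V.scale_right_distrib)
    moreover have "j + j' = a * (s + s')" by (simp add: k(2) k'(2) distrib_left)
    ultimately show "k + k' \<in> ?N" using J(3)[OF k(1) k'(1)] by blast
  next
    fix c
    obtain \<alpha> t where \<alpha>: "\<delta> \<alpha> = 0" "c = \<alpha> + a * t" using const_decomp[OF a(1)] .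
    have jR: "j \<in> R" using J(1) k(1) by blast
    then obtain m where m: "\<delta> j = \<iota> m" using R_iff by blast
    have "\<iota> (scaleK c k) = \<alpha> \<cdot> \<delta> j + a \<cdot> (t \<cdot> \<delta> j + c \<cdot> \<iota> l)"
      unfolding iota_scale k(3) V.scale_right_distrib
      by (simp add: \<alpha>(2) V.scale_left_distrib V.scale_right_distrib algebra_simps)
    then have "\<iota> (scaleK c k) = \<delta> (\<alpha> * j) + a \<cdot> \<iota> (scaleK t m + scaleK c l)"
      by (simp only: delta_const_mult[OF \<alpha>(1)] iota_add iota_scale m)
    moreover have "\<alpha> * j = a * (\<alpha> * s)" by (simp add: k(2) ac_simps)
    ultimately show "scaleK c k \<in> ?N" using J(4)[OF const_in_R[OF \<alpha>(1)] k(1)] by blast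
  }
qed

text \<open>For a nonzero constant \<open>a\<close> in \<open>I\<close>, generators are
  \<open>a\<close>, lifts of generators of I + aS, and lifts of generators modulo aK of the
  derivatives of the multiples of \<open>a\<close> in \<open>I\<close>.\<close>

lemma noetherian_of_quotients:
  assumes S: "noetherian_subring (UNIV :: 's set)"
    and K: "\<And>a. a \<noteq> 0 \<Longrightarrow> \<delta> a = 0 \<Longrightarrow> quotient_finitely_generated scaleK (range (scaleK a))"
  shows "noetherian_subring R"
  unfolding noetherian_subring_def
proof (intro allI impI)
  fix I assume I: "subring_ideal R I"
  show "\<exists>G. finite G \<and> G \<subseteq> I \<and> (\<forall>J. subring_ideal R J \<longrightarrow> G \<subseteq> J \<longrightarrow> I \<subseteq> J)"
  proof (cases "I \<subseteq> {0}")
    case True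
    then show ?thesis using subring_idealD(2) by (intro exI[of _ "{}"]) auto
  next
    case False
    then obtain a where a: "a \<in> I" "a \<noteq> 0" "\<delta> a = 0" using nonzero_ideal_const[OF I] by blast
    let ?S = "\<lambda>J. {s. \<exists>j\<in>J. \<exists>t. s = j + a * t}"
    let ?N = "\<lambda>J. {k. \<exists>j\<in>J. \<exists>s l. j = a * s \<and> \<iota> k = \<delta> j + a \<cdot> \<iota> l}"
    have range_N: "range (scaleK a) \<subseteq> ?N J" if "subring_ideal R J" for J
    proof (rule image_subsetI)
      fix l
      have "\<iota> (scaleK a l) = \<delta> 0 + a \<cdot> \<iota> l" by (simp add: D.zero iota_scale)
      moreover have "(0::'s) = a * 0" by simp
      ultimately show "scaleK a l \<in> ?N J" using subring_idealD(2)[OF that] by blast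
    qed
    obtain G where G: "finite G" "G \<subseteq> ?S I" "\<And>J. subring_ideal UNIV J \<Longrightarrow> G \<subseteq> J \<Longrightarrow> ?S I \<subseteq> J"
      by (rule noetherian_subringE[OF S ideal_plus_principal[OF I a]]) (rule that)
    have "\<forall>g\<in>G. \<exists>i. i \<in> I \<and> (\<exists>t. g = i + a * t)" using G(2) by blast
    from bchoice[OF this] obtain f
      where f: "\<And>g. g \<in> G \<Longrightarrow> f g \<in> I \<and> (\<exists>t. g = f g + a * t)" by blast
    obtain A where A: "finite A" "\<And>k. \<exists>t\<in>K.span A. k - t \<in> range (scaleK a)"
      using K[OF a(2,3)] unfolding K.quotient_finitely_generated_iff[OF K.subspace_range_scale]
      by blast
    have "k \<in> K.span (A \<union> range (scaleK a))" for k
    proof -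
      obtain t where t: "t \<in> K.span A" "k - t \<in> range (scaleK a)" using A(2) by blast
      have "t \<in> K.span (A \<union> range (scaleK a))" using K.span_mono[OF Un_upper1] t(1) by blast
      with K.span_add[OF this K.span_base[OF UnI2[OF t(2)]]] show ?thesis by simp
    qed
    then have "?N I \<subseteq> K.span (A \<union> range (scaleK a))" by blast
    then obtain B where B: "finite B" "B \<subseteq> ?N I" "?N I \<subseteq> K.span (B \<union> range (scaleK a))"
      using K.noetherian_submodule[OF S A(1) subspace_delta_ideal[OF I a(2,3)] range_N[OF I]]
      by blast
    have "\<forall>b\<in>B. \<exists>i. i \<in> I \<and> (\<exists>s l. i = a * s \<and> \<iota> b = \<delta> i + a \<cdot> \<iota> l)" using B(2) by blast
    from bchoice[OF this] obtain h
      where h: "\<And>b. b \<in> B \<Longrightarrow> h b \<in> I \<and> (\<exists>s l. h b = a * s \<and> \<iota> b = \<delta> (h b) + a \<cdot> \<iota> l)"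
      by blast
    have "I \<subseteq> J0" if J0: "subring_ideal R J0" "insert a (f ` G \<union> h ` B) \<subseteq> J0" for J0
    proof
      fix r assume r: "r \<in> I"
      \<comment> \<open>Intersecting with \<open>I\<close> ensures that \<open>r - j\<close> below
        stays in \<open>I\<close>, so that the second family of generators applies to it.\<close>
      define J where "J = I \<inter> J0"
      have J: "subring_ideal R J" unfolding J_def by (rule subring_ideal_Int[OF I J0(1)])
      note JD = subring_idealD[OF J] and ID = subring_idealD[OF I]
      have fJ: "f g \<in> J" if "g \<in> G" for g using J0(2) f that by (auto simp: J_def)
      have hJ: "h b \<in> J" if "b \<in> B" for b using J0(2) h that by (auto simp: J_def)
      have aJ: "a \<in> J" using J0(2) a(1) by (auto simp: J_def)
      have "G \<subseteq> ?S J" using f fJ by blast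
      then have "?S I \<subseteq> ?S J" by (intro G(3) ideal_plus_principal J aJ a)
      moreover have "r \<in> ?S I" using r by (auto intro!: bexI[of _ r] exI[of _ 0])
      ultimately obtain j t where j: "j \<in> J" "r = j + a * t" by blast
      have "B \<subseteq> ?N J" using h hJ by blast
      then have NJ: "?N I \<subseteq> ?N J"
        using B(3) K.span_minimal[OF _ subspace_delta_ideal[OF J a(2,3)], of "B \<union> range (scaleK a)"]
          range_N[OF J] by blast
      have "- 1 * j \<in> J" using R_closed(2,5) JD(4) j(1) by blast
      then have "r + - 1 * j \<in> I" using ID(3)[OF r, of "- 1 * j"] by (simp add: J_def)
      then have at: "a * t \<in> I" using j(2) by simp
      then obtain k where k: "\<delta> (a * t) = \<iota> k" using ID(1) R_iff by blast
      \<comment> \<open>With 0 as the aK-part, \<open>k\<close> belongs to the submodule attached to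
        \<open>I\<close>, which equals the one attached to \<open>J\<close> up to the inclusion just
        shown.\<close>
      have "\<iota> k = \<delta> (a * t) + a \<cdot> \<iota> 0" by (simp only: k iota.zero V.scale_zero_right add_0_right)
      with at have "k \<in> ?N I" by blast
      with NJ obtain i s l where i: "i \<in> J" "i = a * s" "\<iota> k = \<delta> i + a \<cdot> \<iota> l" by blast
      \<comment> \<open>Cancelling \<open>a\<close> shows that \<open>t - s\<close> has its
        derivative in K, so it lies in \<open>R\<close>; the remaining part of \<open>r\<close> is
        thus an \<open>R\<close>-multiple of \<open>a\<close>.\<close>
      have "a \<cdot> \<delta> t = a \<cdot> (\<delta> s + \<iota> l)"
        using k i(3) by (simp add: i(2) delta_const_mult[OF a(3)] D_mult a(3) V.scale_right_distrib)
      then have "\<delta> t = \<delta> s + \<iota> l" using a(2) by simp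
      then have "t - s \<in> R" by (auto simp: R_iff D.diff)
      then have "(t - s) * a \<in> J" using JD(4) aJ by blast
      then have "j + (i + (t - s) * a) \<in> J" using JD(3) i(1) j(1) by blast
      moreover have "j + (i + (t - s) * a) = r" by (simp add: j(2) i(2) algebra_simps)
      ultimately show "r \<in> J0" by (simp add: J_def)
    qed
    moreover have "insert a (f ` G \<union> h ` B) \<subseteq> I" using a(1) f h by blast
    moreover have "finite (insert a (f ` G \<union> h ` B))" using G(1) B(1) by simp
    ultimately show ?thesis by blast
  qed
qed

end

theorem theorem5p2:
  fixes scaleK :: "'s::idom \<Rightarrow> 'k::ab_group_add \<Rightarrow> 'k"
    and scaleFK :: "'s fract \<Rightarrow> 'v::ab_group_add \<Rightarrow> 'v"
    and \<iota> :: "'k \<Rightarrow> 'v"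
    and D :: "'s fract \<Rightarrow> 'v"
    and R :: "'s set"
  assumes "torsion_free_module scaleK"
    and "is_divisible_hull scaleK scaleFK \<iota>"
    and "strongly_twists scaleFK \<iota> D R"
  shows "noetherian_domain (ring_of_type_algebra\<lparr>carrier := R\<rparr>) \<longleftrightarrow>
    noetherian_domain (ring_of_type_algebra :: 's ring) \<and>
    (\<forall>a. a \<noteq> 0 \<and> D (to_fract a) = 0 \<longrightarrow>
       quotient_finitely_generated scaleK (range (scaleK a)))"
proof -
  interpret strong_twist scaleK scaleFK \<iota> D R
    using assms by (simp add: strong_twist_def)
  interpret T: ring "ring_of_type_algebra :: 's ring" ..
  have UNIV: "carrier (ring_of_type_algebra :: 's ring) = UNIV"
    by (simp add: ring_of_type_algebra_def)
  \<comment> \<open>S is treated as the subring \<open>UNIV\<close> of itself, so that one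
    translation serves both rings.\<close>
  have "subring UNIV (ring_of_type_algebra :: 's ring)"
    using T.carrier_is_subring by (simp only: UNIV)
  moreover have "ring_of_type_algebra\<lparr>carrier := UNIV\<rparr> = (ring_of_type_algebra :: 's ring)"
    by (simp add: ring_of_type_algebra_def)
  ultimately have S: "noetherian_domain (ring_of_type_algebra :: 's ring) \<longleftrightarrow>
      noetherian_subring (UNIV :: 's set)"
    using noetherian_domain_iff[of "UNIV :: 's set"] by simp
  show ?thesis
    unfolding noetherian_domain_iff[OF subring_R] S
    using noetherian_overring quotient_finitely_generated_of_noetherian noetherian_of_quotients
    by blast
qed

end
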